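(* Let $R$ be a commutative ring with $1\neq 0$, let $\alpha\in\{\text{atomic},\ \text{strongly atomic},\ \text{m-atomic},\ \text{very strongly atomic}\}$ and $\beta\in\{\text{associate},\ \text{strong associate},\ \text{very strong associate}\}$. Then the following hold. (1) A non-unit $x\in R$ has a finite number of $\alpha$-divisors up to $\beta$ if and only if $V(G_\alpha^\beta(x))$ is finite. (2) A non-unit $x\in R$ has a finite number of $\alpha$-divisors if and only if $V(G_\alpha^\emptyset(x))$ is finite. (3) $R$ is an $\alpha$-$\beta$-divisor finite ring if and only if for all $x\in R$ not a unit, $|V(G_\alpha^\beta(x))|<\infty$. (4) $R$ is a strong-$\alpha$-divisor finite ring (i.e. every non-unit has a finite number of $\alpha$-divisors) if and only if $V(G_\alpha^\emptyset(x))$ is finite for all non-units $x\in R$.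
   Context: $U(R)$ is the group of units of $R$. For $a,b\in R$: $a,b$ are associates, $a\sim b$, if $(a)=(b)$; strong associates, $a\approx b$, if $a=\lambda b$ for some $\lambda\in U(R)$; very strong associates, $a\cong b$, if $a\sim b$ and either $a=b=0$ or ($a=rb$ with $r\in R$ implies $r\in U(R)$). A non-unit $a\in R$ is: irreducible (atomic) if $a=bc$ implies $a\sim b$ or $a\sim c$; strongly irreducible (strongly atomic) if $a=bc$ implies $a\approx b$ or $a\approx c$; m-irreducible (m-atomic) if $(a)$ is maximal among the proper principal ideals of $R$; very strongly irreducible (very strongly atomic) if $a=bc$ implies $a\cong b$ or $a\cong c$. An $\alpha$-divisor of $x$ is a divisor of $x$ that is an $\alpha$ element. $R$ is an $\alpha$-$\beta$-divisor finite ring if every non-unit of $R$ has only finitely many $\alpha$-divisors up to $\beta$. $R$ is a strong-$\alpha$-divisor finite ring if every non-unit of $R$ has only finitely many $\alpha$-divisors. The vertex sets: let $A_\alpha(R)$ be the set of non-units of $R$ that are $\alpha$, let $A_\alpha^\beta(R)$ be a fixed set of representatives of $A_\alpha(R)$ up to $\beta$, and let $A_\alpha^\emptyset(R)=A_\alpha(R)$. The divisor graph $G_\alpha^\beta(x)$ (resp. $G_\alpha^\emptyset(x)$) of a non-unit $x$ has vertex set $\{a\in A_\alpha^\beta(R): a\mid x\}$ (resp. $\{a\in A_\alpha(R): a\mid x\}$). (Edges are not needed for this statement.) *)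

theory Defs
  imports Main
begin

text \<open>The abbreviation \<open>is_unit\<close> of \<^theory>\<open>HOL.Rings\<close> is confined to integral domains.\<close>

abbreviation ring_unit :: "'a::comm_ring_1 \<Rightarrow> bool" where
  "ring_unit u \<equiv> u dvd 1"

definition principal_ideal :: "'a::comm_ring_1 \<Rightarrow> 'a set" where
  "principal_ideal a = range (\<lambda>r. r * a)"

definition associate :: "'a::comm_ring_1 \<Rightarrow> 'a \<Rightarrow> bool" where
  "associate a b \<longleftrightarrow> principal_ideal a = principal_ideal b"

definition strong_associate :: "'a::comm_ring_1 \<Rightarrow> 'a \<Rightarrow> bool" where
  "strong_associate a b \<longleftrightarrow> (\<exists>u. ring_unit u \<and> a = u * b)"

definition very_strong_associate :: "'a::comm_ring_1 \<Rightarrow> 'a \<Rightarrow> bool" where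
  "very_strong_associate a b \<longleftrightarrow>
     associate a b \<and> (a = 0 \<and> b = 0 \<or> (\<forall>r. a = r * b \<longrightarrow> ring_unit r))"

definition atomic :: "'a::comm_ring_1 \<Rightarrow> bool" where
  "atomic a \<longleftrightarrow> \<not> ring_unit a \<and>
     (\<forall>b c. a = b * c \<longrightarrow> associate a b \<or> associate a c)"

definition strongly_atomic :: "'a::comm_ring_1 \<Rightarrow> bool" where
  "strongly_atomic a \<longleftrightarrow> \<not> ring_unit a \<and>
     (\<forall>b c. a = b * c \<longrightarrow> strong_associate a b \<or> strong_associate a c)"

definition m_atomic :: "'a::comm_ring_1 \<Rightarrow> bool" where
  "m_atomic a \<longleftrightarrow> \<not> ring_unit a \<and>
     (\<forall>b. principal_ideal a \<subseteq> principal_ideal b \<and> principal_ideal b \<noteq> UNIV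
        \<longrightarrow> principal_ideal b = principal_ideal a)"

definition very_strongly_atomic :: "'a::comm_ring_1 \<Rightarrow> bool" where
  "very_strongly_atomic a \<longleftrightarrow> \<not> ring_unit a \<and>
     (\<forall>b c. a = b * c \<longrightarrow> very_strong_associate a b \<or> very_strong_associate a c)"

text \<open>
  In the following, \<open>\<alpha>\<close> ranges over the four predicates above and \<open>\<beta>\<close> over the three
  associate relations. Very strong association is symmetric and transitive but not
  reflexive in general: a nontrivial idempotent \<open>e = e * e\<close> is not very strongly
  associate to itself. Hence ``up to \<open>\<beta>\<close>'' identifies elements that are equal or
  \<open>\<beta>\<close>-related, which makes no difference for the other two relations.
\<close>

definition up_to :: "('a \<Rightarrow> 'a \<Rightarrow> bool) \<Rightarrow> ('a \<times> 'a) set" where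
  "up_to \<beta> = {(a, b). a = b \<or> \<beta> a b}"

definition nonunits_that_are :: "('a::comm_ring_1 \<Rightarrow> bool) \<Rightarrow> 'a set" where
  "nonunits_that_are \<alpha> = {a. \<not> ring_unit a \<and> \<alpha> a}"

definition representatives_up_to :: "('a \<Rightarrow> 'a \<Rightarrow> bool) \<Rightarrow> 'a set \<Rightarrow> 'a set \<Rightarrow> bool" where
  "representatives_up_to \<beta> S A \<longleftrightarrow>
     A \<subseteq> S \<and> (\<forall>s\<in>S. \<exists>!a. a \<in> A \<and> (s, a) \<in> up_to \<beta>)"

definition divisors_that_are :: "('a::comm_ring_1 \<Rightarrow> bool) \<Rightarrow> 'a \<Rightarrow> 'a set" where
  "divisors_that_are \<alpha> x = {a. a dvd x \<and> \<alpha> a}"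

definition finitely_many_up_to :: "('a \<Rightarrow> 'a \<Rightarrow> bool) \<Rightarrow> 'a set \<Rightarrow> bool" where
  "finitely_many_up_to \<beta> D \<longleftrightarrow> finite (D // up_to \<beta>)"

definition divisor_finite_ring ::
  "('a::comm_ring_1 \<Rightarrow> bool) \<Rightarrow> ('a \<Rightarrow> 'a \<Rightarrow> bool) \<Rightarrow> bool" where
  "divisor_finite_ring \<alpha> \<beta> \<longleftrightarrow>
     (\<forall>x. \<not> ring_unit x \<longrightarrow> finitely_many_up_to \<beta> (divisors_that_are \<alpha> x))"

definition strong_divisor_finite_ring :: "('a::comm_ring_1 \<Rightarrow> bool) \<Rightarrow> bool" where
  "strong_divisor_finite_ring \<alpha> \<longleftrightarrow>
     (\<forall>x. \<not> ring_unit x \<longrightarrow> finite (divisors_that_are \<alpha> x))"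

text \<open>
  The divisor graph enters only through its vertex set. Its first argument is the set
  from which the vertices are drawn: \<^term>\<open>nonunits_that_are \<alpha>\<close> itself, or a set of
  representatives of it up to \<open>\<beta>\<close>.
\<close>

definition divisor_graph_vertices :: "'a::comm_ring_1 set \<Rightarrow> 'a \<Rightarrow> 'a set" where
  "divisor_graph_vertices A x = {a \<in> A. a dvd x}"

end

theory Submission
  imports Defs
begin

text \<open>
  All three associate relations, once made reflexive, are equivalence relations that
  refine mutual divisibility (\<open>equiv_up_to\<close>, \<open>associate_if_related\<close>).
  Mutually divisible elements divide the same \<open>x\<close>, so the \<open>\<alpha>\<close>-divisors
  of \<open>x\<close> form a subset of the \<open>\<alpha>\<close> elements that is saturated under
  \<open>\<beta>\<close>: the chosen representative of an \<open>\<alpha>\<close>-divisor of \<open>x\<close> is again an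
  \<open>\<alpha>\<close>-divisor of \<open>x\<close>, hence a vertex. Sending a vertex to its \<open>\<beta>\<close>-class is therefore a
  bijection from the vertex set onto the classes of \<open>\<alpha>\<close>-divisors
  (\<open>bij_betw_representatives_quotient\<close>), and one side is finite exactly when the other is.
  Without choosing representatives, the
  two sets are equal, because \<open>\<alpha>\<close> elements are non-units. The statements about the
  whole ring quantify these equivalences over all non-units.

  The one delicate point is that very strong association is symmetric and transitive,
  although its second clause treats the two elements differently and it
  may fail to be reflexive.
\<close>

lemma associate_iff_dvd: "associate a b \<longleftrightarrow> a dvd b \<and> b dvd a"
proof -
  have "principal_ideal c = {z. c dvd z}" for c :: 'a
    by (auto simp: principal_ideal_def dvd_def mult.commute)
  then show ?thesis
    unfolding associate_def by (auto intro: dvd_trans)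
qed

lemma strong_associate_sym:
  assumes "strong_associate a b"
  shows "strong_associate b a"
proof -
  obtain u v where "a = u * b" "1 = u * v"
    using assms unfolding strong_associate_def dvd_def by blast
  moreover from this have "v * (u * b) = b"
    by (simp add: mult.commute[of u v] flip: mult.assoc)
  ultimately have "b = v * a" "1 = v * u"
    by (simp_all add: mult.commute)
  then show ?thesis
    unfolding strong_associate_def dvd_def by blast
qed

lemma ring_unit_mult_iff: "ring_unit (a * b) \<longleftrightarrow> ring_unit a \<and> ring_unit b"
  using dvd_mult_left[of a b 1] dvd_mult_right[of a b 1] mult_dvd_mono[of a 1 b 1] by auto

lemma strong_associate_trans:
  assumes "strong_associate a b" "strong_associate b c"
  shows "strong_associate a c"
  using assms unfolding strong_associate_def by (metis mult.assoc ring_unit_mult_iff)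

lemma strong_associate_imp_associate: "strong_associate a b \<Longrightarrow> associate a b"
  using strong_associate_sym[of a b] unfolding associate_iff_dvd strong_associate_def
  by (metis dvd_triv_right)

text \<open>
  For nonzero \<open>a\<close> and \<open>b\<close>, write \<open>a = u * b\<close>. If \<open>b = r * a\<close>, then \<open>a = u * (r * (u * b))\<close>, so very strong
  association makes the whole factor \<open>u * r * u\<close> of \<open>b\<close> a unit, and with it \<open>r\<close>.
\<close>

lemma very_strong_associate_sym:
  assumes "very_strong_associate a b"
  shows "very_strong_associate b a"
proof (cases "a = 0 \<and> b = 0")
  case False
  have ab: "associate a b" and unit: "\<And>r. a = r * b \<Longrightarrow> ring_unit r"
    using assms False unfolding very_strong_associate_def by auto
  obtain u where u: "a = u * b"
    using ab unfolding associate_iff_dvd by (metis dvdE mult.commute)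
  have "ring_unit r" if "b = r * a" for r
  proof -
    have "a = (u * r * u) * b"
      using u that by (metis mult.assoc)
    then show ?thesis
      using unit ring_unit_mult_iff by blast
  qed
  then show ?thesis
    using ab unfolding very_strong_associate_def associate_iff_dvd by blast
qed (use assms in \<open>auto simp: very_strong_associate_def\<close>)

text \<open>
  If \<open>a = r * c\<close> and \<open>c = s * b\<close>, then \<open>a = (r * s) * b\<close>. When \<open>b\<close> is nonzero, the first
  hypothesis makes \<open>r * s\<close> a unit, and with it \<open>r\<close>.
\<close>

lemma very_strong_associate_trans:
  assumes "very_strong_associate a b" "very_strong_associate b c"
  shows "very_strong_associate a c"
proof -
  have dvds: "a dvd b" "b dvd a" "b dvd c" "c dvd b"
    using assms unfolding very_strong_associate_def associate_iff_dvd by auto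
  then have ac: "associate a c"
    unfolding associate_iff_dvd by (blast intro: dvd_trans)
  show ?thesis
  proof (cases "b = 0")
    case True
    then show ?thesis
      using dvds ac unfolding very_strong_associate_def by simp
  next
    case False
    then have unit: "\<And>r. a = r * b \<Longrightarrow> ring_unit r"
      using assms(1) unfolding very_strong_associate_def by auto
    obtain s where s: "c = s * b"
      using dvds(3) by (metis dvdE mult.commute)
    have "ring_unit r" if "a = r * c" for r
      using unit[of "r * s"] that s by (simp add: mult.assoc ring_unit_mult_iff)
    then show ?thesis
      using ac unfolding very_strong_associate_def by blast
  qed
qed

lemma associate_if_related:
  assumes "\<beta> \<in> {associate, strong_associate, very_strong_associate}" "\<beta> a b"
  shows "associate a b"
  using assms strong_associate_imp_associate[of a b] by (auto simp: very_strong_associate_def)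

lemma equiv_up_to:
  assumes "\<beta> \<in> {associate, strong_associate, very_strong_associate}"
  shows "equiv UNIV (up_to \<beta>)"
proof -
  have "associate b a" if "associate a b" for a b :: 'a
    using that by (simp add: associate_def)
  then have sym: "\<And>a b. \<beta> a b \<Longrightarrow> \<beta> b a"
    using assms strong_associate_sym very_strong_associate_sym by blast
  have "associate a c" if "associate a b" "associate b c" for a b c :: 'a
    using that by (simp add: associate_def)
  then have trans: "\<And>a b c. \<beta> a b \<Longrightarrow> \<beta> b c \<Longrightarrow> \<beta> a c"
    using assms strong_associate_trans very_strong_associate_trans by blast
  show ?thesis
  proof (intro equivI refl_onI symI transI)
    show "(b, a) \<in> up_to \<beta>" if "(a, b) \<in> up_to \<beta>" for a b
      using that sym unfolding up_to_def by blast
    show "(a, c) \<in> up_to \<beta>" if "(a, b) \<in> up_to \<beta>" "(b, c) \<in> up_to \<beta>" for a b c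
      using that trans unfolding up_to_def by blast
  qed (simp_all add: up_to_def)
qed

lemma bij_betw_representatives_quotient:
  assumes equiv: "equiv UNIV (up_to \<beta>)"
    and reps: "representatives_up_to \<beta> S A"
    and "D \<subseteq> S"
    and saturated: "\<And>d s. d \<in> D \<Longrightarrow> s \<in> S \<Longrightarrow> (d, s) \<in> up_to \<beta> \<Longrightarrow> s \<in> D"
  shows "bij_betw (\<lambda>a. up_to \<beta> `` {a}) (A \<inter> D) (D // up_to \<beta>)"
proof (rule bij_betwI')
  have "A \<subseteq> S" and unique: "\<And>s. s \<in> S \<Longrightarrow> \<exists>!a. a \<in> A \<and> (s, a) \<in> up_to \<beta>"
    using reps unfolding representatives_up_to_def by auto
  fix a b
  assume "a \<in> A \<inter> D" "b \<in> A \<inter> D"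
  moreover have "(a, a) \<in> up_to \<beta>"
    unfolding up_to_def by simp
  ultimately show "(up_to \<beta> `` {a} = up_to \<beta> `` {b}) = (a = b)"
    using unique[of a] \<open>A \<subseteq> S\<close> eq_equiv_class[OF _ equiv] by blast
next
  fix a
  assume "a \<in> A \<inter> D"
  then show "up_to \<beta> `` {a} \<in> D // up_to \<beta>"
    by (auto intro: quotientI)
next
  fix C
  assume "C \<in> D // up_to \<beta>"
  then obtain d where d: "d \<in> D" "C = up_to \<beta> `` {d}"
    by (auto elim: quotientE)
  then obtain a where "a \<in> A" "(d, a) \<in> up_to \<beta>"
    using reps \<open>D \<subseteq> S\<close> unfolding representatives_up_to_def by blast
  moreover from this have "a \<in> D"
    using saturated d(1) reps unfolding representatives_up_to_def by blast
  ultimately show "\<exists>a \<in> A \<inter> D. C = up_to \<beta> `` {a}"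
    using d(2) equiv_class_eq[OF equiv] by blast
qed

lemma divisor_graph_vertices_nonunits:
  assumes "\<alpha> \<in> {atomic, strongly_atomic, m_atomic, very_strongly_atomic}"
  shows "divisor_graph_vertices (nonunits_that_are \<alpha>) x = divisors_that_are \<alpha> x"
  using assms
  by (auto simp: divisor_graph_vertices_def nonunits_that_are_def divisors_that_are_def
      atomic_def strongly_atomic_def m_atomic_def very_strongly_atomic_def)

lemma finitely_many_divisors_iff_finite_vertices:
  assumes \<alpha>: "\<alpha> \<in> {atomic, strongly_atomic, m_atomic, very_strongly_atomic}"
    and \<beta>: "\<beta> \<in> {associate, strong_associate, very_strong_associate}"
    and reps: "representatives_up_to \<beta> (nonunits_that_are \<alpha>) A"
  shows "finitely_many_up_to \<beta> (divisors_that_are \<alpha> x) \<longleftrightarrow>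
    finite (divisor_graph_vertices A x)"
proof -
  let ?S = "nonunits_that_are \<alpha>" and ?D = "divisors_that_are \<alpha> x"
  have D: "?D = {a \<in> ?S. a dvd x}"
    using divisor_graph_vertices_nonunits[OF \<alpha>] by (simp add: divisor_graph_vertices_def)
  have "s \<in> ?D" if "d \<in> ?D" "s \<in> ?S" "(d, s) \<in> up_to \<beta>" for d s
  proof -
    have "s dvd d"
      using that(3) associate_if_related[OF \<beta>] by (auto simp: up_to_def associate_iff_dvd)
    then show ?thesis
      using that D by (auto intro: dvd_trans)
  qed
  then have "bij_betw (\<lambda>a. up_to \<beta> `` {a}) (A \<inter> ?D) (?D // up_to \<beta>)"
    using bij_betw_representatives_quotient[OF equiv_up_to[OF \<beta>] reps] D by blast
  moreover have "divisor_graph_vertices A x = A \<inter> ?D"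
    using reps D unfolding divisor_graph_vertices_def representatives_up_to_def by blast
  ultimately show ?thesis
    by (simp add: finitely_many_up_to_def bij_betw_finite)
qed

theorem theorem5p9:
  fixes \<alpha> :: "'a::comm_ring_1 \<Rightarrow> bool"
    and \<beta> :: "'a \<Rightarrow> 'a \<Rightarrow> bool"
    and A :: "'a set"
  assumes "\<alpha> \<in> {atomic, strongly_atomic, m_atomic, very_strongly_atomic}"
    and "\<beta> \<in> {associate, strong_associate, very_strong_associate}"
    and "representatives_up_to \<beta> (nonunits_that_are \<alpha>) A"
  shows "(\<forall>x. \<not> ring_unit x \<longrightarrow>
            (finitely_many_up_to \<beta> (divisors_that_are \<alpha> x) \<longleftrightarrow>
             finite (divisor_graph_vertices A x)))
       \<and> (\<forall>x. \<not> ring_unit x \<longrightarrow>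
            (finite (divisors_that_are \<alpha> x) \<longleftrightarrow>
             finite (divisor_graph_vertices (nonunits_that_are \<alpha>) x)))
       \<and> (divisor_finite_ring \<alpha> \<beta> \<longleftrightarrow>
            (\<forall>x. \<not> ring_unit x \<longrightarrow> finite (divisor_graph_vertices A x)))
       \<and> (strong_divisor_finite_ring \<alpha> \<longleftrightarrow>
            (\<forall>x. \<not> ring_unit x \<longrightarrow>
               finite (divisor_graph_vertices (nonunits_that_are \<alpha>) x)))"
  unfolding divisor_finite_ring_def strong_divisor_finite_ring_def
    divisor_graph_vertices_nonunits[OF assms(1)]
    finitely_many_divisors_iff_finite_vertices[OF assms]
  by simp

end
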